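(* Let $N=n_1\cdots n_d$ with $n_1,\dots,n_d$ positive integers. For $1\le i\le d$, let $\mathrm{span}\{\mathrm{id}_N\}^{\perp_i}$ be the orthogonal complement of $\mathrm{span}\{\mathrm{id}_N\}$ in the linear subspace $$\mathcal{V}_i=\left\{\mathrm{id}_{n_1}\otimes\cdots\otimes\mathrm{id}_{n_{i-1}}\otimes B\otimes\mathrm{id}_{n_{i+1}}\otimes\cdots\otimes\mathrm{id}_{n_d} : B\in\mathbb{R}^{n_i\times n_i}\right\}\subset\mathbb{R}^{N\times N}.$$ Let $\Delta=\mathrm{span}\{\mathrm{id}_N\}^{\bot}\cap\mathcal{L}(\mathbb{R}^{N\times N})$. Then $$\Delta=\bigoplus_{i=1}^d\mathrm{span}\{\mathrm{id}_N\}^{\perp_i}.$$ Furthermore, a matrix $A$ belongs to $\Delta$ if and only if it has the form $$A=\sum_{i=1}^d \mathrm{id}_{n_1}\otimes\cdots\otimes\mathrm{id}_{n_{i-1}}\otimes A_i\otimes\mathrm{id}_{n_{i+1}}\otimes\cdots\otimes\mathrm{id}_{n_d},\qquad A_i\in\mathbb{R}^{n_i\times n_i},\quad \mathrm{tr}(A_i)=0,\quad i=1,\dots,d.$$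
   Context: Fix a factorization $N=n_1\cdots n_d$; $\otimes$ denotes the Kronecker product of matrices and $\mathrm{id}_n$ the $n\times n$ identity matrix. A matrix $A\in\mathbb{R}^{N\times N}$ is Laplacian-like if there exist $A_i\in\mathbb{R}^{n_i\times n_i}$, $1\le i\le d$, such that $A=\sum_{i=1}^d \mathrm{id}_{n_1}\otimes\cdots\otimes\mathrm{id}_{n_{i-1}}\otimes A_i\otimes\mathrm{id}_{n_{i+1}}\otimes\cdots\otimes\mathrm{id}_{n_d}$. The set of Laplacian-like matrices (for the fixed factorization) is a linear subspace denoted $\mathcal{L}(\mathbb{R}^{N\times N})$. The space $\mathbb{R}^{N\times N}$ carries the inner product $\langle A,B\rangle=\mathrm{tr}(A^{\top}B)$; orthogonality is with respect to it, and $\mathcal{U}^{\bot}$ denotes the orthogonal complement of a linear subspace $\mathcal{U}$ in $\mathbb{R}^{N\times N}$. *)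

theory Defs
  imports "Jordan_Normal_Form.VS_Connect"
begin

definition mat_trace :: "'a::comm_monoid_add mat \<Rightarrow> 'a" where
  "mat_trace A = (\<Sum>i<dim_row A. A $$ (i, i))"

definition kronecker :: "'a::times mat \<Rightarrow> 'a mat \<Rightarrow> 'a mat"  (infixr \<open>\<otimes>\<^sub>K\<close> 70) where
  "A \<otimes>\<^sub>K B = mat (dim_row A * dim_row B) (dim_col A * dim_col B)
     (\<lambda>(i, j). A $$ (i div dim_row B, j div dim_col B) * B $$ (i mod dim_row B, j mod dim_col B))"

(* The empty product is the 1 x 1 identity, a two-sided unit for the Kronecker product. *)
definition kronecker_list :: "'a::semiring_1 mat list \<Rightarrow> 'a mat" where
  "kronecker_list As = foldr (\<otimes>\<^sub>K) As (1\<^sub>m 1)"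

lemma dim_kronecker [simp]:
  "dim_row (A \<otimes>\<^sub>K B) = dim_row A * dim_row B"
  "dim_col (A \<otimes>\<^sub>K B) = dim_col A * dim_col B"
  by (simp_all add: kronecker_def)

lemma kronecker_one_right: "A \<otimes>\<^sub>K 1\<^sub>m 1 = (A :: 'a::semiring_1 mat)"
proof (rule eq_matI)
  fix i j assume "i < dim_row A" "j < dim_col A"
  then show "(A \<otimes>\<^sub>K 1\<^sub>m 1) $$ (i, j) = A $$ (i, j)"
    unfolding kronecker_def by simp
qed simp_all

lemma kronecker_one_left: "1\<^sub>m 1 \<otimes>\<^sub>K A = (A :: 'a::semiring_1 mat)"
proof (rule eq_matI)
  fix i j assume "i < dim_row A" "j < dim_col A"
  then show "(1\<^sub>m 1 \<otimes>\<^sub>K A) $$ (i, j) = A $$ (i, j)"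
    unfolding kronecker_def by simp
qed simp_all

lemma dim_kronecker_list:
  "dim_row (kronecker_list As) = prod_list (map dim_row As)"
  "dim_col (kronecker_list As) = prod_list (map dim_col As)"
  by (induction As) (simp_all add: kronecker_list_def)

definition mat_inner :: "real mat \<Rightarrow> real mat \<Rightarrow> real" where
  "mat_inner A B = mat_trace (transpose_mat A * B)"

(* The orthogonal complement of U inside the ambient space V. *)
definition orth_compl_in :: "real mat set \<Rightarrow> real mat set \<Rightarrow> real mat set" where
  "orth_compl_in V U = {A \<in> V. \<forall>B\<in>U. mat_inner B A = 0}"

abbreviation mat_space :: "nat \<Rightarrow> (real, real mat) module" where
  "mat_space N \<equiv> module_mat TYPE(real) N N"

definition span_id :: "nat \<Rightarrow> real mat set" where
  "span_id N = LinearCombinations.module.span class_ring (mat_space N) {1\<^sub>m N}"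

(* The W i are subspaces of V, and each element of U is in exactly one way a sum of one element
   from each W i, all such sums lying in U. The extensional function space (functions
   "undefined" outside I) is what makes the uniqueness meaningful. *)
definition internal_direct_sum ::
  "('k, 'm) ring_scheme \<Rightarrow> ('k, 'v, 'n) module_scheme \<Rightarrow> 'i set \<Rightarrow> ('i \<Rightarrow> 'v set) \<Rightarrow> 'v set \<Rightarrow> bool" where
  "internal_direct_sum K V I W U \<longleftrightarrow>
     finite I \<and> (\<forall>i\<in>I. VectorSpace.subspace K (W i) V) \<and>
     bij_betw (\<lambda>w. finsum V w I) (\<Pi>\<^sub>E i\<in>I. W i) U"

(* A factorization N = n_1 ... n_d is represented by the list ns = [n_1, ..., n_d], so that
   N = prod_list ns and d = length ns. Positions are counted from 0. *)

(* id (x) ... (x) id (x) B (x) id (x) ... (x) id, with B at position i. *)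
definition kron_at :: "nat list \<Rightarrow> nat \<Rightarrow> real mat \<Rightarrow> real mat" where
  "kron_at ns i B = kronecker_list ((map 1\<^sub>m ns)[i := B])"

definition kron_sum :: "nat list \<Rightarrow> (nat \<Rightarrow> real mat) \<Rightarrow> real mat" where
  "kron_sum ns As = finsum (mat_space (prod_list ns)) (\<lambda>i. kron_at ns i (As i)) {..<length ns}"

definition laplacian_like :: "nat list \<Rightarrow> real mat set" where
  "laplacian_like ns =
     {kron_sum ns As | As. \<forall>i<length ns. As i \<in> carrier_mat (ns ! i) (ns ! i)}"

definition site_space :: "nat list \<Rightarrow> nat \<Rightarrow> real mat set" where
  "site_space ns i = {kron_at ns i B | B. B \<in> carrier_mat (ns ! i) (ns ! i)}"

definition Delta :: "nat list \<Rightarrow> real mat set" where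
  "Delta ns = orth_compl_in (carrier_mat (prod_list ns) (prod_list ns)) (span_id (prod_list ns))
     \<inter> laplacian_like ns"

lemma kron_at_carrier:
  assumes "i < length ns" "B \<in> carrier_mat (ns ! i) (ns ! i)"
  shows "kron_at ns i B \<in> carrier_mat (prod_list ns) (prod_list ns)"
proof -
  have "(map dim_row (map 1\<^sub>m ns :: real mat list))[i := dim_row B] = ns"
    "(map dim_col (map 1\<^sub>m ns :: real mat list))[i := dim_col B] = ns"
    using assms by (auto simp: list_eq_iff_nth_eq nth_list_update)
  then show ?thesis
    unfolding kron_at_def carrier_mat_def mem_Collect_eq dim_kronecker_list map_update by simp
qed

lemma span_id_eq: "span_id N = {c \<cdot>\<^sub>m 1\<^sub>m N | c. True}"
proof -
  interpret matrix_vs N N "TYPE(real)" .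
  have "span {1\<^sub>m N} = {lincomb a {1\<^sub>m N} | a. a \<in> {1\<^sub>m N} \<rightarrow> (UNIV :: real set)}"
    by (rule finite_span) auto
  also have "\<dots> = {c \<cdot>\<^sub>m 1\<^sub>m N | c. True}"
  proof -
    have l: "lincomb a {1\<^sub>m N} = a (1\<^sub>m N) \<cdot>\<^sub>m 1\<^sub>m N" for a :: "real mat \<Rightarrow> real"
      by (simp add: lincomb_def)
    have "\<exists>a. c \<cdot>\<^sub>m 1\<^sub>m N = lincomb a {1\<^sub>m N} \<and> a \<in> {1\<^sub>m N} \<rightarrow> UNIV" for c :: real
      by (rule exI[of _ "\<lambda>_. c"]) (simp add: l)
    then show ?thesis
      using l by blast
  qed
  finally show ?thesis by (simp add: span_id_def)
qed

end

theory Submission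
  imports Defs
begin

text \<open>Orthogonality to \<open>id\<close> means trace zero, and placing \<open>B\<close> at site \<open>i\<close> multiplies its trace
  by \<open>N / n\<^sub>i > 0\<close>. If the whole sum is trace-free, replacing each \<open>A\<^sub>i\<close> by
  \<open>A\<^sub>i - (tr A\<^sub>i / n\<^sub>i) id\<close> changes it by a multiple of \<open>id\<close> of trace zero, i.e. not at all.
  Uniqueness of the trace-free \<open>A\<^sub>i\<close> follows by induction on the number of factors, splitting off the
  first one with a partial trace.\<close>

section \<open>The trace as a linear functional\<close>

lemma mat_trace_add:
  assumes "A \<in> carrier_mat n n" "B \<in> carrier_mat n n"
  shows "mat_trace (A + B) = mat_trace A + mat_trace B"
  using assms by (simp add: mat_trace_def sum.distrib)

lemma mat_trace_smult:
  fixes A :: "'a::semiring_0 mat"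
  assumes "A \<in> carrier_mat n n"
  shows "mat_trace (c \<cdot>\<^sub>m A) = c * mat_trace A"
  using assms by (simp add: mat_trace_def sum_distrib_left)

lemma mat_trace_one: "mat_trace (1\<^sub>m n :: 'a::semiring_1 mat) = of_nat n"
  by (simp add: mat_trace_def)

lemma mat_trace_zero: "mat_trace (0\<^sub>m n n :: 'a::semiring_1 mat) = 0"
  by (simp add: mat_trace_def)

section \<open>Entries, bilinearity and trace of the Kronecker product\<close>

text \<open>The bound excludes k = 0, the one case in which a remainder modulo k could fail to lie
  below k.\<close>

lemma less_mult_imp_mod_less: "r < m * k \<Longrightarrow> r mod k < (k::nat)"
  by (cases k) simp_all

lemma index_kronecker:
  assumes "A \<in> carrier_mat m n" "B \<in> carrier_mat k l" "r < m * k" "c < n * l"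
  shows "(A \<otimes>\<^sub>K B) $$ (r, c) = A $$ (r div k, c div l) * B $$ (r mod k, c mod l)"
    and "r div k < m" "c div l < n" "r mod k < k" "c mod l < l"
proof -
  show "(A \<otimes>\<^sub>K B) $$ (r, c) = A $$ (r div k, c div l) * B $$ (r mod k, c mod l)"
    using assms by (auto simp: kronecker_def)
  show "r div k < m" "c div l < n"
    using assms by (simp_all add: less_mult_imp_div_less)
  show "r mod k < k" "c mod l < l"
    using assms(3,4) by (simp_all add: less_mult_imp_mod_less)
qed

lemma kronecker_add_left:
  fixes A :: "'a::semiring_0 mat"
  assumes "A \<in> carrier_mat m n" "B \<in> carrier_mat m n" "C \<in> carrier_mat k l"
  shows "(A + B) \<otimes>\<^sub>K C = A \<otimes>\<^sub>K C + B \<otimes>\<^sub>K C"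
  using assms by (intro eq_matI)
    (simp_all add: index_kronecker(1)[where m = m and n = n and k = k and l = l] less_mult_imp_div_less
      less_mult_imp_mod_less[where m = m] less_mult_imp_mod_less[where m = n] distrib_right)

lemma kronecker_add_right:
  fixes A :: "'a::semiring_0 mat"
  assumes "A \<in> carrier_mat m n" "B \<in> carrier_mat k l" "C \<in> carrier_mat k l"
  shows "A \<otimes>\<^sub>K (B + C) = A \<otimes>\<^sub>K B + A \<otimes>\<^sub>K C"
  using assms by (intro eq_matI)
    (simp_all add: index_kronecker(1)[where m = m and n = n and k = k and l = l] less_mult_imp_div_less
      less_mult_imp_mod_less[where m = m] less_mult_imp_mod_less[where m = n] distrib_left)

lemma kronecker_smult_left:
  fixes A :: "'a::semiring_0 mat"
  assumes "A \<in> carrier_mat m n" "B \<in> carrier_mat k l"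
  shows "(c \<cdot>\<^sub>m A) \<otimes>\<^sub>K B = c \<cdot>\<^sub>m (A \<otimes>\<^sub>K B)"
  using assms by (intro eq_matI)
    (simp_all add: index_kronecker(1)[where m = m and n = n and k = k and l = l] less_mult_imp_div_less
      less_mult_imp_mod_less[where m = m] less_mult_imp_mod_less[where m = n] mult.assoc)

lemma kronecker_smult_right:
  fixes A :: "'a::comm_semiring_0 mat"
  assumes "A \<in> carrier_mat m n" "B \<in> carrier_mat k l"
  shows "A \<otimes>\<^sub>K (c \<cdot>\<^sub>m B) = c \<cdot>\<^sub>m (A \<otimes>\<^sub>K B)"
  using assms by (intro eq_matI)
    (simp_all add: index_kronecker(1)[where m = m and n = n and k = k and l = l] less_mult_imp_div_less
      less_mult_imp_mod_less[where m = m] less_mult_imp_mod_less[where m = n] mult.left_commute)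

lemma kronecker_one_one: "1\<^sub>m m \<otimes>\<^sub>K 1\<^sub>m n = (1\<^sub>m (m * n) :: 'a::semiring_1 mat)"
proof (rule eq_matI)
  fix r c
  assume "r < dim_row (1\<^sub>m (m * n) :: 'a mat)" "c < dim_col (1\<^sub>m (m * n) :: 'a mat)"
  then have rc: "r < m * n" "c < m * n"
    by simp_all
  have "(1\<^sub>m m \<otimes>\<^sub>K 1\<^sub>m n) $$ (r, c) =
      (1\<^sub>m m :: 'a mat) $$ (r div n, c div n) * 1\<^sub>m n $$ (r mod n, c mod n)"
    by (rule index_kronecker(1)[OF one_carrier_mat one_carrier_mat rc])
  \<comment> \<open>Quotient and remainder by n together determine an index, so the big diagonal
    consists exactly of the pairs of small diagonal positions.\<close>
  moreover have "r = c \<longleftrightarrow> r div n = c div n \<and> r mod n = c mod n"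
    by (metis div_mult_mod_eq)
  ultimately show "(1\<^sub>m m \<otimes>\<^sub>K 1\<^sub>m n) $$ (r, c) = (1\<^sub>m (m * n) :: 'a mat) $$ (r, c)"
    using rc index_kronecker(2-5)[OF one_carrier_mat one_carrier_mat rc] by simp
qed simp_all

text \<open>The diagonal of length m * n is cut into m consecutive blocks of length n. Block i is
  the diagonal of B scaled by the i-th diagonal entry of A.\<close>

lemma mat_trace_kronecker:
  fixes A :: "'a::semiring_0 mat"
  assumes "A \<in> carrier_mat m m" "B \<in> carrier_mat n n"
  shows "mat_trace (A \<otimes>\<^sub>K B) = mat_trace A * mat_trace B"
proof -
  have block: "(\<Sum>r = i * n..<i * n + n. (A \<otimes>\<^sub>K B) $$ (r, r)) = (\<Sum>j<n. A $$ (i, i) * B $$ (j, j))"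
    if "i < m" for i
  proof -
    have "(\<Sum>r = i * n..<i * n + n. (A \<otimes>\<^sub>K B) $$ (r, r)) =
        (\<Sum>j = 0..<n. (A \<otimes>\<^sub>K B) $$ (j + i * n, j + i * n))"
      using sum.shift_bounds_nat_ivl[of "\<lambda>r. (A \<otimes>\<^sub>K B) $$ (r, r)" 0 "i * n" n]
      by (simp add: add.commute)
    also have "\<dots> = (\<Sum>j = 0..<n. A $$ (i, i) * B $$ (j, j))"
    proof (rule sum.cong)
      fix j assume "j \<in> {0..<n}"
      then have "j < n" by simp
      then have "j + i * n < Suc i * n" by simp
      also have "\<dots> \<le> m * n" using that by (intro mult_right_mono) simp_all
      finally have "j + i * n < m * n" .
      from index_kronecker(1)[OF assms this this] \<open>j < n\<close>
      show "(A \<otimes>\<^sub>K B) $$ (j + i * n, j + i * n) = A $$ (i, i) * B $$ (j, j)" by simp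
    qed simp
    finally show ?thesis by (simp add: atLeast0LessThan)
  qed
  have "mat_trace (A \<otimes>\<^sub>K B) = (\<Sum>i<m. \<Sum>r = i * n..<i * n + n. (A \<otimes>\<^sub>K B) $$ (r, r))"
    using assms by (simp add: mat_trace_def sum.nat_group)
  also have "\<dots> = (\<Sum>i<m. \<Sum>j<n. A $$ (i, i) * B $$ (j, j))"
    using block by (intro sum.cong[OF refl]) simp
  also have "\<dots> = mat_trace A * mat_trace B"
    using assms by (simp add: mat_trace_def sum_product)
  finally show ?thesis .
qed

section \<open>Placing a matrix at one site\<close>

lemma kronecker_list_one: "kronecker_list (map 1\<^sub>m ns) = (1\<^sub>m (prod_list ns) :: 'a::semiring_1 mat)"
proof (induction ns)
  case (Cons n ns)
  then show ?case
    using kronecker_one_one[of n "prod_list ns", where 'a = 'a] by (simp add: kronecker_list_def)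
qed (simp add: kronecker_list_def)

text \<open>With \<open>kron_at_Cons_Suc\<close> this is the recursion behind the inductions below:
  the site is either the first factor, followed by one large identity, or it lies in the tail,
  behind an identity.\<close>

lemma kron_at_Cons_0: "kron_at (n # ns) 0 B = B \<otimes>\<^sub>K 1\<^sub>m (prod_list ns)"
  using kronecker_list_one[of ns, where 'a = real] by (simp add: kron_at_def kronecker_list_def)

lemma kron_at_Cons_Suc: "kron_at (n # ns) (Suc i) B = 1\<^sub>m n \<otimes>\<^sub>K kron_at ns i B"
  by (simp add: kron_at_def kronecker_list_def)

lemma kron_at_add:
  assumes "i < length ns" "B \<in> carrier_mat (ns ! i) (ns ! i)" "C \<in> carrier_mat (ns ! i) (ns ! i)"
  shows "kron_at ns i (B + C) = kron_at ns i B + kron_at ns i C"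
  using assms
proof (induction ns arbitrary: i)
  case (Cons n ns)
  show ?case
  proof (cases i)
    case 0
    with Cons.prems show ?thesis
      by (simp add: kron_at_Cons_0 kronecker_add_left[OF _ _ one_carrier_mat])
  next
    case (Suc j)
    with Cons show ?thesis
      by (simp add: kron_at_Cons_Suc kronecker_add_right[OF one_carrier_mat kron_at_carrier kron_at_carrier])
  qed
qed simp

lemma kron_at_smult:
  assumes "i < length ns" "B \<in> carrier_mat (ns ! i) (ns ! i)"
  shows "kron_at ns i (c \<cdot>\<^sub>m B) = c \<cdot>\<^sub>m kron_at ns i B"
  using assms
proof (induction ns arbitrary: i)
  case (Cons n ns)
  show ?case
  proof (cases i)
    case 0
    with Cons.prems show ?thesis
      by (simp add: kron_at_Cons_0 kronecker_smult_left[OF _ one_carrier_mat])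
  next
    case (Suc j)
    with Cons show ?thesis
      by (simp add: kron_at_Cons_Suc kronecker_smult_right[OF one_carrier_mat kron_at_carrier])
  qed
qed simp

lemma kron_at_one: "i < length ns \<Longrightarrow> kron_at ns i (1\<^sub>m (ns ! i)) = 1\<^sub>m (prod_list ns)"
  using kronecker_list_one[of ns, where 'a = real]
  by (metis kron_at_def list_update_id nth_map)

text \<open>The zero matrix is 0 times the identity, so homogeneity reduces the claim to
  \<open>kron_at_one\<close>.\<close>

lemma kron_at_zero:
  assumes "i < length ns"
  shows "kron_at ns i (0\<^sub>m (ns ! i) (ns ! i)) = 0\<^sub>m (prod_list ns) (prod_list ns)"
proof -
  have zero: "0 \<cdot>\<^sub>m 1\<^sub>m n = (0\<^sub>m n n :: real mat)" for n
    by (rule eq_matI) simp_all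
  show ?thesis
    using kron_at_smult[OF assms one_carrier_mat, of 0] kron_at_one[OF assms] by (simp add: zero)
qed

text \<open>The trace is multiplicative and each identity contributes its size, so the factor is the
  product of all sizes except that of site i. Multiplying by the missing size completes the product
  to N and avoids a division.\<close>

lemma mat_trace_kron_at:
  assumes "i < length ns" "B \<in> carrier_mat (ns ! i) (ns ! i)"
  shows "real (ns ! i) * mat_trace (kron_at ns i B) = real (prod_list ns) * mat_trace B"
  using assms
proof (induction ns arbitrary: i)
  case (Cons n ns)
  show ?case
  proof (cases i)
    case 0
    with Cons.prems show ?thesis
      by (simp add: kron_at_Cons_0 mat_trace_kronecker[OF _ one_carrier_mat] mat_trace_one)
  next
    case (Suc j)
    with Cons show ?thesis
      by (simp add: kron_at_Cons_Suc mat_trace_kronecker[OF one_carrier_mat kron_at_carrier]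
          mat_trace_one mult.left_commute)
  qed
qed simp

section \<open>Finite sums in the module of matrices\<close>

text \<open>Passes from the abstract sum of the module to ordinary sums of entries; the identities
  for Kronecker sums below are checked entrywise through it.\<close>

lemma finsum_mat:
  fixes f :: "'i \<Rightarrow> 'a::field mat"
  assumes "finite I" "f \<in> I \<rightarrow> carrier_mat n m"
  shows finsum_mat_carrier: "finsum (module_mat TYPE('a) n m) f I \<in> carrier_mat n m"
    and index_finsum_mat: "r < n \<Longrightarrow> c < m \<Longrightarrow>
      finsum (module_mat TYPE('a) n m) f I $$ (r, c) = (\<Sum>i\<in>I. f i $$ (r, c))"
proof -
  interpret matrix_vs n m "TYPE('a)" .
  show closed: "finsum V f I \<in> carrier_mat n m"
    using assms(2) by (rule M.finsum_closed)
  show "finsum V f I $$ (r, c) = (\<Sum>i\<in>I. f i $$ (r, c))" if "r < n" "c < m"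
    using assms
  proof (induction I rule: finite_induct)
    case empty
    then show ?case using that by simp
  next
    case (insert x I)
    then have f: "f \<in> I \<rightarrow> carrier_mat n m" "f x \<in> carrier_mat n m" by auto
    have "finsum V f I \<in> carrier_mat n m"
      using f(1) by (rule M.finsum_closed)
    then have "(f x + finsum V f I) $$ (r, c) = f x $$ (r, c) + finsum V f I $$ (r, c)"
      using that by (intro index_add_mat(1)) auto
    then show ?case
      using insert f by (simp add: M.finsum_insert)
  qed
qed

lemma mat_trace_finsum:
  fixes f :: "'i \<Rightarrow> 'a::field mat"
  assumes "finite I" "f \<in> I \<rightarrow> carrier_mat n n"
  shows "mat_trace (finsum (module_mat TYPE('a) n n) f I) = (\<Sum>i\<in>I. mat_trace (f i))"
proof -
  have "mat_trace (finsum (module_mat TYPE('a) n n) f I) = (\<Sum>r<n. \<Sum>i\<in>I. f i $$ (r, r))"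
    using finsum_mat_carrier[OF assms] by (simp add: mat_trace_def index_finsum_mat[OF assms])
  also have "\<dots> = (\<Sum>i\<in>I. \<Sum>r<n. f i $$ (r, r))"
    by (rule sum.swap)
  also have "\<dots> = (\<Sum>i\<in>I. mat_trace (f i))"
    using assms(2) by (intro sum.cong) (auto simp: mat_trace_def Pi_def)
  finally show ?thesis .
qed

section \<open>Kronecker sums of families of matrices\<close>

text \<open>Values from \<open>length ns\<close> on are arbitrary, so uniqueness of a family can
  only be claimed below \<open>length ns\<close>.\<close>

definition site_family :: "nat list \<Rightarrow> (nat \<Rightarrow> real mat) \<Rightarrow> bool" where
  "site_family ns As \<longleftrightarrow> (\<forall>i<length ns. As i \<in> carrier_mat (ns ! i) (ns ! i))"

lemma site_familyD: "site_family ns As \<Longrightarrow> i < length ns \<Longrightarrow> As i \<in> carrier_mat (ns ! i) (ns ! i)"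
  by (simp add: site_family_def)

lemma site_family_kron_at:
  "site_family ns As \<Longrightarrow>
    (\<lambda>i. kron_at ns i (As i)) \<in> {..<length ns} \<rightarrow> carrier_mat (prod_list ns) (prod_list ns)"
  by (auto simp: site_family_def kron_at_carrier)

lemma kron_sum_carrier: "site_family ns As \<Longrightarrow> kron_sum ns As \<in> carrier_mat (prod_list ns) (prod_list ns)"
  unfolding kron_sum_def by (rule finsum_mat_carrier) (simp_all add: site_family_kron_at)

lemma index_kron_sum:
  assumes "site_family ns As" "r < prod_list ns" "c < prod_list ns"
  shows "kron_sum ns As $$ (r, c) = (\<Sum>i<length ns. kron_at ns i (As i) $$ (r, c))"
  unfolding kron_sum_def
  using assms by (intro index_finsum_mat) (simp_all add: site_family_kron_at)

lemma mat_trace_kron_sum: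
  "site_family ns As \<Longrightarrow> mat_trace (kron_sum ns As) = (\<Sum>i<length ns. mat_trace (kron_at ns i (As i)))"
  unfolding kron_sum_def by (rule mat_trace_finsum) (simp_all add: site_family_kron_at)

text \<open>Addition and scaling in one statement. Both uses take c = -1: to subtract the trace
  parts of a family, and to compare two families with the same sum.\<close>

lemma kron_sum_linear:
  assumes A: "site_family ns As" and B: "site_family ns Bs"
  shows "kron_sum ns (\<lambda>i. As i + c \<cdot>\<^sub>m Bs i) = kron_sum ns As + c \<cdot>\<^sub>m kron_sum ns Bs"
proof -
  have AB: "site_family ns (\<lambda>i. As i + c \<cdot>\<^sub>m Bs i)"
    using A B by (simp add: site_family_def)
  show ?thesis
  proof (rule eq_matI)
    fix r s
    assume "r < dim_row (kron_sum ns As + c \<cdot>\<^sub>m kron_sum ns Bs)"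
      "s < dim_col (kron_sum ns As + c \<cdot>\<^sub>m kron_sum ns Bs)"
    then have rs: "r < prod_list ns" "s < prod_list ns"
      using kron_sum_carrier[OF B] by auto
    have entry: "kron_at ns i (As i + c \<cdot>\<^sub>m Bs i) $$ (r, s) =
        kron_at ns i (As i) $$ (r, s) + c * kron_at ns i (Bs i) $$ (r, s)" if "i < length ns" for i
    proof -
      note a = site_familyD[OF A that] and b = site_familyD[OF B that]
      show ?thesis
        using rs kron_at_carrier[OF that a] kron_at_carrier[OF that b]
        by (simp add: kron_at_add[OF that a] kron_at_smult[OF that b] b)
    qed
    show "kron_sum ns (\<lambda>i. As i + c \<cdot>\<^sub>m Bs i) $$ (r, s) = (kron_sum ns As + c \<cdot>\<^sub>m kron_sum ns Bs) $$ (r, s)"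
      using rs kron_sum_carrier[OF A] kron_sum_carrier[OF B]
      by (simp add: index_kron_sum A B AB entry sum.distrib sum_distrib_left)
  qed (use kron_sum_carrier[OF AB] kron_sum_carrier[OF B] in auto)
qed

text \<open>Every site after the first leaves an identity on the first factor, which can be pulled
  out of the sum. This produces the shape A (x) id + id (x) S needed for induction on the number of
  factors.\<close>

lemma kron_sum_Cons:
  assumes "site_family (n # ns) As"
  shows "kron_sum (n # ns) As = As 0 \<otimes>\<^sub>K 1\<^sub>m (prod_list ns) + 1\<^sub>m n \<otimes>\<^sub>K kron_sum ns (\<lambda>i. As (Suc i))"
proof -
  let ?As = "\<lambda>i. As (Suc i)" and ?N = "prod_list ns"
  have tail: "site_family ns ?As"
    using assms by (auto simp: site_family_def)
  have A0: "As 0 \<in> carrier_mat n n"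
    using assms by (auto simp: site_family_def)
  note S = kron_sum_carrier[OF tail]
  show ?thesis
  proof (rule eq_matI)
    fix r c
    assume "r < dim_row (As 0 \<otimes>\<^sub>K 1\<^sub>m ?N + 1\<^sub>m n \<otimes>\<^sub>K kron_sum ns ?As)"
      "c < dim_col (As 0 \<otimes>\<^sub>K 1\<^sub>m ?N + 1\<^sub>m n \<otimes>\<^sub>K kron_sum ns ?As)"
    then have rc: "r < n * ?N" "c < n * ?N"
      using S by auto
    note idx = index_kronecker[OF one_carrier_mat _ rc]
    have "(\<Sum>i<length ns. (1\<^sub>m n \<otimes>\<^sub>K kron_at ns i (?As i)) $$ (r, c)) =
        (\<Sum>i<length ns. (1\<^sub>m n :: real mat) $$ (r div ?N, c div ?N) * kron_at ns i (?As i) $$ (r mod ?N, c mod ?N))"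
      by (intro sum.cong idx(1)) (auto intro: kron_at_carrier site_familyD[OF tail])
    also have "\<dots> = (1\<^sub>m n \<otimes>\<^sub>K kron_sum ns ?As) $$ (r, c)"
      by (simp only: idx(1)[OF S] index_kron_sum[OF tail idx(4,5)[OF S]] sum_distrib_left)
    finally have "(\<Sum>i<length ns. (1\<^sub>m n \<otimes>\<^sub>K kron_at ns i (?As i)) $$ (r, c)) = \<dots>" .
    then show "kron_sum (n # ns) As $$ (r, c) = (As 0 \<otimes>\<^sub>K 1\<^sub>m ?N + 1\<^sub>m n \<otimes>\<^sub>K kron_sum ns ?As) $$ (r, c)"
      using rc S
      by (simp add: index_kron_sum[OF assms] sum.lessThan_Suc_shift kron_at_Cons_0 kron_at_Cons_Suc
          del: sum.lessThan_Suc)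
  qed (use kron_sum_carrier[OF assms] S in auto)
qed

section \<open>Uniqueness of trace-free summands\<close>

text \<open>The partial trace over the second tensor factor of \<open>A \<otimes> id + id \<otimes> S\<close> is
  \<open>n A + tr(S) id\<close>, so it recovers \<open>A\<close> when \<open>S\<close> is trace-free.\<close>

lemma kronecker_sum_eq_0:
  fixes A :: "real mat"
  assumes A: "A \<in> carrier_mat m m" and S: "S \<in> carrier_mat n n" and "mat_trace S = 0" "0 < m" "0 < n"
    and zero: "A \<otimes>\<^sub>K 1\<^sub>m n + 1\<^sub>m m \<otimes>\<^sub>K S = 0\<^sub>m (m * n) (m * n)"
  shows "A = 0\<^sub>m m m" "S = 0\<^sub>m n n"
proof -
  \<comment> \<open>The equation is read at row i * n + k and column j * n + l, whose quotients and
    remainders by n recover (i, j) and (k, l).\<close>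
  have entry: "A $$ (i, j) * (1\<^sub>m n :: real mat) $$ (k, l) + (1\<^sub>m m :: real mat) $$ (i, j) * S $$ (k, l) = 0"
    if "i < m" "j < m" "k < n" "l < n" for i j k l
  proof -
    have less: "a * n + b < m * n" if "a < m" "b < n" for a b
    proof -
      have "a * n + b < Suc a * n" using that by simp
      also have "\<dots> \<le> m * n" using that by (intro mult_right_mono) simp_all
      finally show ?thesis .
    qed
    note rc = less[OF that(1,3)] less[OF that(2,4)]
    show ?thesis
      using arg_cong[OF zero, of "\<lambda>M. M $$ (i * n + k, j * n + l)"] rc that S
        index_kronecker(1)[OF A one_carrier_mat rc] index_kronecker(1)[OF one_carrier_mat S rc]
      by simp
  qed
  show A0: "A = 0\<^sub>m m m"
  proof (rule eq_matI)
    fix i j assume "i < dim_row (0\<^sub>m m m :: real mat)" "j < dim_col (0\<^sub>m m m :: real mat)"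
    then have ij: "i < m" "j < m" by simp_all
    \<comment> \<open>Setting k = l and summing over k is the partial trace: the entry of A is
      counted n times, and the entries of S add up to its trace.\<close>
    have "0 = (\<Sum>k<n. A $$ (i, j) + (1\<^sub>m m :: real mat) $$ (i, j) * S $$ (k, k))"
      using entry[OF ij] by (intro sum.neutral[symmetric]) fastforce
    also have "\<dots> = n * A $$ (i, j) + (1\<^sub>m m :: real mat) $$ (i, j) * mat_trace S"
      using S by (simp add: sum.distrib mat_trace_def flip: sum_distrib_left)
    finally show "A $$ (i, j) = 0\<^sub>m m m $$ (i, j)"
      using assms ij by simp
  qed (use A in auto)
  show "S = 0\<^sub>m n n"
  proof (rule eq_matI)
    fix k l assume "k < dim_row (0\<^sub>m n n :: real mat)" "l < dim_col (0\<^sub>m n n :: real mat)"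
    \<comment> \<open>Position (0, 0) of the first factor exists since m > 0; there the identity has
      entry 1 and A is already known to vanish.\<close>
    then show "S $$ (k, l) = 0\<^sub>m n n $$ (k, l)"
      using entry[of 0 0 k l] \<open>0 < m\<close> A0 by simp
  qed (use S in auto)
qed

text \<open>The terms of the tail sum are trace-free, hence so is the tail sum. Thus
  \<open>kronecker_sum_eq_0\<close> makes both the first matrix and the tail sum vanish, and the
  induction hypothesis applies to the tail.\<close>

lemma kron_sum_eq_0:
  assumes "\<forall>n\<in>set ns. 0 < n" "site_family ns As" "\<forall>i<length ns. mat_trace (As i) = 0"
    and "kron_sum ns As = 0\<^sub>m (prod_list ns) (prod_list ns)" "i < length ns"
  shows "As i = 0\<^sub>m (ns ! i) (ns ! i)"
  using assms
proof (induction ns arbitrary: As i)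
  case (Cons n ns)
  let ?As = "\<lambda>i. As (Suc i)" and ?N = "prod_list ns"
  have pos: "0 < n" "\<forall>n\<in>set ns. 0 < n" "0 < ?N"
    using Cons.prems(1) by (auto simp: prod_list_zero_iff intro!: Nat.gr0I)
  have tail: "site_family ns ?As" and A0: "As 0 \<in> carrier_mat n n"
    using Cons.prems(2) by (auto simp: site_family_def)
  have tr: "mat_trace (?As j) = 0" if "j < length ns" for j
    using Cons.prems(3) that by simp
  have "mat_trace (kron_at ns j (?As j)) = 0" if "j < length ns" for j
    using mat_trace_kron_at[OF that site_familyD[OF tail that]] tr[OF that] pos(2) nth_mem[OF that]
    by fastforce
  then have "mat_trace (kron_sum ns ?As) = 0"
    by (simp add: mat_trace_kron_sum[OF tail])
  note zero = kronecker_sum_eq_0[OF A0 kron_sum_carrier[OF tail] this pos(1,3)]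
  have eq: "As 0 \<otimes>\<^sub>K 1\<^sub>m ?N + 1\<^sub>m n \<otimes>\<^sub>K kron_sum ns ?As = 0\<^sub>m (n * ?N) (n * ?N)"
    using Cons.prems(4) kron_sum_Cons[OF Cons.prems(2)] by simp
  show ?case
  proof (cases i)
    case 0
    then show ?thesis using zero(1)[OF eq] by simp
  next
    case (Suc j)
    then show ?thesis
      using Cons.IH[OF pos(2) tail _ zero(2)[OF eq], of j] tr Cons.prems(5) by simp
  qed
qed simp

section \<open>Orthogonality to the identity and the elements of \<open>Delta\<close>\<close>

text \<open>Pairing with c id gives c times the trace, because the identity is symmetric. The
  ambient V is left open to cover both the full matrix space and the site spaces.\<close>

lemma orth_compl_in_span_id:
  assumes "V \<subseteq> carrier_mat N N"
  shows "orth_compl_in V (span_id N) = {A \<in> V. mat_trace A = 0}"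
proof -
  have inner: "mat_inner (c \<cdot>\<^sub>m 1\<^sub>m N) A = c * mat_trace A" if "A \<in> carrier_mat N N" for c A
  proof -
    have "transpose_mat (c \<cdot>\<^sub>m 1\<^sub>m N :: real mat) = c \<cdot>\<^sub>m 1\<^sub>m N"
      by (rule eq_matI) auto
    moreover have "c \<cdot>\<^sub>m 1\<^sub>m N * A = c \<cdot>\<^sub>m A"
      using that by (simp add: mult_smult_assoc_mat[OF one_carrier_mat])
    ultimately show ?thesis
      using that by (simp add: mat_inner_def mat_trace_smult)
  qed
  show ?thesis
  proof (intro equalityI subsetI)
    fix A assume "A \<in> orth_compl_in V (span_id N)"
    then have "A \<in> V" "mat_inner (1 \<cdot>\<^sub>m 1\<^sub>m N) A = 0"
      unfolding orth_compl_in_def span_id_eq by blast+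
    then show "A \<in> {A \<in> V. mat_trace A = 0}"
      using assms inner[of A 1] by auto
  next
    fix A assume "A \<in> {A \<in> V. mat_trace A = 0}"
    then show "A \<in> orth_compl_in V (span_id N)"
      using assms inner unfolding orth_compl_in_def span_id_eq by auto
  qed
qed

text \<open>Moves the trace condition from the N x N matrix to the small matrix at site i: by
  \<open>mat_trace_kron_at\<close> the two traces differ only by the nonzero numbers N and
  \<open>ns ! i\<close>.\<close>

lemma site_orth_compl:
  assumes "\<forall>n\<in>set ns. 0 < n" "i < length ns"
  shows "orth_compl_in (site_space ns i) (span_id (prod_list ns)) =
    {kron_at ns i B | B. B \<in> carrier_mat (ns ! i) (ns ! i) \<and> mat_trace B = 0}"
proof -
  have "0 < ns ! i" "0 \<notin> set ns"
    using assms by auto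
  then have "mat_trace (kron_at ns i B) = 0 \<longleftrightarrow> mat_trace B = 0"
    if "B \<in> carrier_mat (ns ! i) (ns ! i)" for B
    using mat_trace_kron_at[OF assms(2) that] by auto
  moreover have "site_space ns i \<subseteq> carrier_mat (prod_list ns) (prod_list ns)"
    using kron_at_carrier[OF assms(2)] by (auto simp: site_space_def)
  ultimately show ?thesis
    by (auto simp: orth_compl_in_span_id site_space_def)
qed

lemma Delta_iff:
  assumes pos: "\<forall>n\<in>set ns. 0 < n"
  shows "A \<in> Delta ns \<longleftrightarrow>
    (\<exists>As. site_family ns As \<and> (\<forall>i<length ns. mat_trace (As i) = 0) \<and> A = kron_sum ns As)"
proof
  have pos': "0 < ns ! i" if "i < length ns" for i
    using pos that by auto
  let ?N = "prod_list ns"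
  have Delta: "A \<in> Delta ns \<longleftrightarrow> (\<exists>As. site_family ns As \<and> A = kron_sum ns As) \<and> mat_trace A = 0"
    using kron_sum_carrier
    by (auto simp: Delta_def orth_compl_in_span_id laplacian_like_def site_family_def[abs_def])
  {
    assume "A \<in> Delta ns"
    then obtain As where As: "site_family ns As" "A = kron_sum ns As" and tr: "mat_trace A = 0"
      using Delta by blast
    \<comment> \<open>\<open>Is i\<close> is the orthogonal projection of \<open>As i\<close> onto
      the multiples of the identity, and \<open>Bs i\<close> is the trace-free remainder.\<close>
    define Is where "Is i = (mat_trace (As i) / real (ns ! i)) \<cdot>\<^sub>m (1\<^sub>m (ns ! i) :: real mat)" for i
    define Bs where "Bs i = As i + (-1) \<cdot>\<^sub>m Is i" for i
    have Is: "site_family ns Is"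
      by (simp add: site_family_def Is_def)
    have trBs: "mat_trace (Bs i) = 0" if "i < length ns" for i
    proof -
      have "mat_trace (Bs i) = mat_trace (As i) + - mat_trace (Is i)"
        unfolding Bs_def using site_familyD[OF As(1) that] site_familyD[OF Is that]
        by (simp add: mat_trace_add[where n = "ns ! i"] mat_trace_smult[where n = "ns ! i"])
      also have "\<dots> = 0"
        using pos'[OF that] by (simp add: Is_def mat_trace_smult[OF one_carrier_mat] mat_trace_one)
      finally show ?thesis .
    qed
    \<comment> \<open>At its site each projection becomes a multiple of the N x N identity. The
      coefficients are chosen in a form that visibly adds up to tr A / N, which is 0.\<close>
    have at: "kron_at ns i (Is i) = (mat_trace (kron_at ns i (As i)) / ?N) \<cdot>\<^sub>m 1\<^sub>m ?N"
      if "i < length ns" for i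
    proof -
      have "0 \<notin> set ns" using pos by auto
      then have "mat_trace (As i) / ns ! i = mat_trace (kron_at ns i (As i)) / ?N"
        using mat_trace_kron_at[OF that site_familyD[OF As(1) that]] pos'[OF that]
        by (simp add: field_simps)
      then show ?thesis
        by (simp add: Is_def kron_at_smult[OF that one_carrier_mat] kron_at_one[OF that])
    qed
    have "kron_sum ns Is = 0\<^sub>m ?N ?N"
    proof (rule eq_matI)
      fix r c assume "r < dim_row (0\<^sub>m ?N ?N :: real mat)" "c < dim_col (0\<^sub>m ?N ?N :: real mat)"
      then have rc: "r < ?N" "c < ?N" by simp_all
      then have "kron_sum ns Is $$ (r, c) =
          (\<Sum>i<length ns. mat_trace (kron_at ns i (As i)) / ?N * (1\<^sub>m ?N :: real mat) $$ (r, c))"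
        by (simp add: index_kron_sum[OF Is] at)
      also have "\<dots> = mat_trace A / ?N * (1\<^sub>m ?N :: real mat) $$ (r, c)"
        by (simp only: As mat_trace_kron_sum[OF As(1)] sum_divide_distrib sum_distrib_right)
      finally show "kron_sum ns Is $$ (r, c) = 0\<^sub>m ?N ?N $$ (r, c)"
        using tr rc by simp
    qed (use kron_sum_carrier[OF Is] in auto)
    then have "kron_sum ns Bs = kron_sum ns As + (-1) \<cdot>\<^sub>m 0\<^sub>m ?N ?N"
      unfolding Bs_def using kron_sum_linear[OF As(1) Is, of "-1"] by simp
    also have "\<dots> = A"
      using As kron_sum_carrier[OF As(1)] by (intro eq_matI) auto
    finally have "A = kron_sum ns Bs" ..
    moreover have "site_family ns Bs"
      using As(1) Is by (simp add: site_family_def Bs_def)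
    ultimately show "\<exists>As. site_family ns As \<and> (\<forall>i<length ns. mat_trace (As i) = 0) \<and> A = kron_sum ns As"
      using trBs by blast
  }
  assume "\<exists>As. site_family ns As \<and> (\<forall>i<length ns. mat_trace (As i) = 0) \<and> A = kron_sum ns As"
  then obtain As where As: "site_family ns As" "\<forall>i<length ns. mat_trace (As i) = 0" "A = kron_sum ns As"
    by blast
  have "mat_trace (kron_at ns i (As i)) = 0" if "i < length ns" for i
    using mat_trace_kron_at[OF that site_familyD[OF As(1) that]] As(2) pos'[OF that] that by simp
  then have "mat_trace A = 0"
    by (simp add: As(3) mat_trace_kron_sum[OF As(1)])
  with As show "A \<in> Delta ns"
    using Delta by blast
qed

section \<open>The direct sum decomposition\<close>

text \<open>By \<open>site_orth_compl\<close> the set is the image of the trace-free matrices under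
  the linear map \<open>kron_at ns i\<close>.\<close>

lemma site_orth_compl_subspace:
  assumes pos: "\<forall>n\<in>set ns. 0 < n" and i: "i < length ns"
  shows "VectorSpace.subspace class_ring (orth_compl_in (site_space ns i) (span_id (prod_list ns)))
    (mat_space (prod_list ns))"
proof -
  interpret matrix_vs "prod_list ns" "prod_list ns" "TYPE(real)" .
  note W = site_orth_compl[OF pos i]
  show ?thesis
  proof (intro subspace.intro submodule.intro)
    fix v w :: "real mat" and c :: real
    assume v: "v \<in> orth_compl_in (site_space ns i) (span_id (prod_list ns))"
    then obtain B where B: "B \<in> carrier_mat (ns ! i) (ns ! i)" "mat_trace B = 0" "v = kron_at ns i B"
      unfolding W by blast
    {
      assume "w \<in> orth_compl_in (site_space ns i) (span_id (prod_list ns))"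
      then obtain C where C: "C \<in> carrier_mat (ns ! i) (ns ! i)" "mat_trace C = 0" "w = kron_at ns i C"
        unfolding W by blast
      have "v + w = kron_at ns i (B + C)" "mat_trace (B + C) = 0" "B + C \<in> carrier_mat (ns ! i) (ns ! i)"
        using B C i by (simp_all add: kron_at_add mat_trace_add)
      then show "v \<oplus>\<^bsub>V\<^esub> w \<in> orth_compl_in (site_space ns i) (span_id (prod_list ns))"
        unfolding W by (auto simp: module_mat_simps)
    }
    have "c \<cdot>\<^sub>m v = kron_at ns i (c \<cdot>\<^sub>m B)" "mat_trace (c \<cdot>\<^sub>m B) = 0" "c \<cdot>\<^sub>m B \<in> carrier_mat (ns ! i) (ns ! i)"
      using B i by (simp_all add: kron_at_smult mat_trace_smult)
    then show "c \<odot>\<^bsub>V\<^esub> v \<in> orth_compl_in (site_space ns i) (span_id (prod_list ns))"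
      unfolding W by (auto simp: module_mat_simps)
  next
    show "orth_compl_in (site_space ns i) (span_id (prod_list ns)) \<subseteq> carrier V"
      unfolding W using kron_at_carrier[OF i] by (auto simp: module_mat_simps)
    show "\<zero>\<^bsub>V\<^esub> \<in> orth_compl_in (site_space ns i) (span_id (prod_list ns))"
      unfolding W module_mat_simps mem_Collect_eq
      using kron_at_zero[OF i] mat_trace_zero zero_carrier_mat by metis
    show "vectorspace class_ring V" by (rule matrix_vs)
    then show "Module.module class_ring V" by (rule vectorspace.axioms)
  qed
qed

text \<open>Surjectivity is the existence of trace-free summands from \<open>Delta_iff\<close>;
  injectivity is \<open>kron_sum_eq_0\<close> applied to the difference of two families.\<close>

lemma site_orth_compl_bij:
  assumes pos: "\<forall>n\<in>set ns. 0 < n"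
  shows "bij_betw (\<lambda>w. finsum (mat_space (prod_list ns)) w {..<length ns})
    (\<Pi>\<^sub>E i\<in>{..<length ns}. orth_compl_in (site_space ns i) (span_id (prod_list ns))) (Delta ns)"
proof -
  let ?N = "prod_list ns" and ?I = "{..<length ns}"
  let ?P = "\<Pi>\<^sub>E i\<in>?I. orth_compl_in (site_space ns i) (span_id ?N)"
  interpret matrix_vs ?N ?N "TYPE(real)" .
  have finsum: "finsum V w ?I = kron_sum ns As"
    if "site_family ns As" "\<And>i. i < length ns \<Longrightarrow> w i = kron_at ns i (As i)" for w As
    unfolding kron_sum_def using site_family_kron_at[OF that(1)] that(2)
    by (intro M.finsum_cong') simp_all
  \<comment> \<open>Chooses a trace-free small matrix at every site, so that elements of the product
    space can be handled as families.\<close>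
  have rep: "\<exists>As. site_family ns As \<and> (\<forall>i<length ns. mat_trace (As i) = 0) \<and>
      (\<forall>i<length ns. w i = kron_at ns i (As i))" if "w \<in> ?P" for w
  proof -
    have "\<exists>B. B \<in> carrier_mat (ns ! i) (ns ! i) \<and> mat_trace B = 0 \<and> w i = kron_at ns i B"
      if "i < length ns" for i
      using PiE_mem[OF \<open>w \<in> ?P\<close>, of i] that site_orth_compl[OF pos that] by auto
    then show ?thesis
      unfolding site_family_def by metis
  qed
  show ?thesis
  proof (rule bij_betw_imageI)
    show "inj_on (\<lambda>w. finsum V w ?I) ?P"
    proof (rule inj_onI)
      fix v w assume v: "v \<in> ?P" and w: "w \<in> ?P" and eq: "finsum V v ?I = finsum V w ?I"
      obtain As where As: "site_family ns As" "\<forall>i<length ns. mat_trace (As i) = 0"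
        "\<forall>i<length ns. v i = kron_at ns i (As i)" using rep[OF v] by blast
      obtain Bs where Bs: "site_family ns Bs" "\<forall>i<length ns. mat_trace (Bs i) = 0"
        "\<forall>i<length ns. w i = kron_at ns i (Bs i)" using rep[OF w] by blast
      let ?Ds = "\<lambda>i. As i + (-1) \<cdot>\<^sub>m Bs i"
      have D: "site_family ns ?Ds"
        using As(1) Bs(1) by (simp add: site_family_def)
      have "kron_sum ns As = kron_sum ns Bs"
        using eq finsum As Bs by metis
      then have "kron_sum ns ?Ds = kron_sum ns Bs + (-1) \<cdot>\<^sub>m kron_sum ns Bs"
        by (simp add: kron_sum_linear[OF As(1) Bs(1)])
      also have "\<dots> = 0\<^sub>m ?N ?N"
        using kron_sum_carrier[OF Bs(1)] by (intro eq_matI) auto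
      finally have D0: "kron_sum ns ?Ds = 0\<^sub>m ?N ?N" .
      have trD: "\<forall>i<length ns. mat_trace (?Ds i) = 0"
      proof (intro allI impI)
        fix i assume i: "i < length ns"
        show "mat_trace (?Ds i) = 0"
          using site_familyD[OF As(1) i] site_familyD[OF Bs(1) i] As(2) Bs(2) i
          by (simp add: mat_trace_add[where n = "ns ! i"] mat_trace_smult[where n = "ns ! i"])
      qed
      \<comment> \<open>Not only the placed matrices but already the small trace-free ones
        coincide.\<close>
      have "As i = Bs i" if i: "i < length ns" for i
      proof (rule eq_matI)
        note a = site_familyD[OF As(1) i] and b = site_familyD[OF Bs(1) i]
        show "dim_row (As i) = dim_row (Bs i)" "dim_col (As i) = dim_col (Bs i)"
          using a b by auto
        fix r c assume "r < dim_row (Bs i)" "c < dim_col (Bs i)"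
        then show "As i $$ (r, c) = Bs i $$ (r, c)"
          using arg_cong[OF kron_sum_eq_0[OF pos D trD D0 i], of "\<lambda>M. M $$ (r, c)"] a b by simp
      qed
      then have "v i = w i" if "i \<in> ?I" for i
        using As(3) Bs(3) that by simp
      \<comment> \<open>Both functions are \<open>undefined\<close> outside \<open>?I\<close>, so
        agreement on \<open>?I\<close> gives equality.\<close>
      then show "v = w"
        using v w by (intro PiE_ext[of v ?I _ w]) auto
    qed
    show "(\<lambda>w. finsum V w ?I) ` ?P = Delta ns"
    proof (intro equalityI subsetI)
      fix A assume "A \<in> (\<lambda>w. finsum V w ?I) ` ?P"
      then obtain w where w: "w \<in> ?P" "A = finsum V w ?I" by blast
      then show "A \<in> Delta ns"
        using rep[OF w(1)] finsum Delta_iff[OF pos] by metis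
    next
      fix A assume "A \<in> Delta ns"
      then obtain As where As: "site_family ns As" "\<forall>i<length ns. mat_trace (As i) = 0"
        "A = kron_sum ns As" using Delta_iff[OF pos] by blast
      \<comment> \<open>The restriction to \<open>?I\<close> puts the function into the extensional
        product.\<close>
      let ?w = "\<lambda>i\<in>?I. kron_at ns i (As i)"
      have "?w \<in> ?P"
      proof (rule restrict_PiE_iff[THEN iffD2], rule ballI)
        fix i assume "i \<in> ?I"
        then have i: "i < length ns" by simp
        show "kron_at ns i (As i) \<in> orth_compl_in (site_space ns i) (span_id ?N)"
          unfolding site_orth_compl[OF pos i] using site_familyD[OF As(1) i] As(2) i by blast
      qed
      moreover have "A = finsum V ?w ?I"
        unfolding As(3) by (rule finsum[OF As(1), symmetric]) simp
      ultimately show "A \<in> (\<lambda>w. finsum V w ?I) ` ?P"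
        by (intro image_eqI)
    qed
  qed
qed

theorem theorem2:
  fixes ns :: "nat list"
  assumes "\<forall>n\<in>set ns. 0 < n"
  shows "internal_direct_sum class_ring (mat_space (prod_list ns)) {..<length ns}
           (\<lambda>i. orth_compl_in (site_space ns i) (span_id (prod_list ns))) (Delta ns)
       \<and> (\<forall>A. A \<in> Delta ns \<longleftrightarrow>
             (\<exists>As. (\<forall>i<length ns. As i \<in> carrier_mat (ns ! i) (ns ! i) \<and> mat_trace (As i) = 0)
                 \<and> A = kron_sum ns As))"
proof
  show "internal_direct_sum class_ring (mat_space (prod_list ns)) {..<length ns}
      (\<lambda>i. orth_compl_in (site_space ns i) (span_id (prod_list ns))) (Delta ns)"
    unfolding internal_direct_sum_def
    using site_orth_compl_subspace[OF assms] site_orth_compl_bij[OF assms] by auto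
  show "\<forall>A. A \<in> Delta ns \<longleftrightarrow>
      (\<exists>As. (\<forall>i<length ns. As i \<in> carrier_mat (ns ! i) (ns ! i) \<and> mat_trace (As i) = 0)
        \<and> A = kron_sum ns As)"
    unfolding Delta_iff[OF assms] site_family_def by blast
qed

end
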